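(* In the setting of the periodic log-normal approximation (below), with $\boldsymbol\Phi_{D^\star}(\theta)\in\overline{\mathbf{CM}}(n)$, suppose at least one of the following holds: (1) $\omega=n$; (2) $\delta_{k_3}=n$ for some $k_3\in\{1,\dots,\omega\}$; (3) $\overline\omega=n$; (4) $\overline\delta_{k_4}=n$ for some $k_4\in\{1,\dots,\overline\omega\}$. Then $\Sigma^d_\epsilon(t)$ is positive definite for every $t\ge0$.
   Context: Setting: $D^\star:[0,\infty)\to\mathbb{R}^{n\times n}$, $\Lambda^\star:[0,\infty)\to\mathbb{R}^{n\times N}$ continuous and $\theta$-periodic (in the paper, $D^\star(t)$ is the Jacobian with respect to $\ln\mathbf{x}$ of $F_i(t,\mathbf{x})=f_i(t,\mathbf{x})/x_i-\frac\epsilon2\sum_jg_{ij}^2(t,\mathbf{x})$ at $e^{\boldsymbol\Psi^\star_\epsilon(t)}$ and $\Lambda^\star(t)=(g_{ij}(t,e^{\boldsymbol\Psi^\star_\epsilon(t)}))$). $\boldsymbol\Phi_{D^\star}$ is the fundamental matrix with $\boldsymbol\Phi_{D^\star}(0)=\mathbf{I}_n$; $\overline{\mathbf{CM}}(n)$ is the set of real $n\times n$ matrices with all eigenvalues of modulus in $(0,1)$. $\Upsilon(t)=\int_0^t(\boldsymbol\Phi_{D^\star}(t)\boldsymbol\Phi_{D^\star}^{-1}(s)\Lambda^\star(s))(\cdots)^{\top}ds$; $\Sigma^d_\epsilon(0)$ is the unique symmetric solution of $\boldsymbol\Phi_{D^\star}(\theta)\Sigma\boldsymbol\Phi_{D^\star}(\theta)^\top-\Sigma+\epsilon\Upsilon(\theta)=\mathbb{O}$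 and $\Sigma^d_\epsilon(t)=\boldsymbol\Phi_{D^\star}(t)\Sigma^d_\epsilon(0)\boldsymbol\Phi_{D^\star}^\top(t)+\epsilon\Upsilon(t)$, $\epsilon>0$. $E_{n,j}$ is the diagonal matrix with a single $1$ at $(j,j)$; $\mathbf{u}_j$ the $j$-th standard basis vector. $\omega=\operatorname{rank}\Upsilon(\theta)$; $\mathcal{H}_\epsilon$ orthogonal with $\mathcal{H}_\epsilon\Upsilon(\theta)\mathcal{H}_\epsilon^\top=\sum_{k=1}^\omega\lambda_k^\oplus E_{n,\mu_k}$, $\lambda_k^\oplus>0$, $\mu_1<\dots<\mu_\omega$; $A_{[3]}=\mathcal{H}_\epsilon\boldsymbol\Phi_{D^\star}(\theta)\mathcal{H}_\epsilon^{-1}$ and $\delta_k:=\dim\operatorname{span}\{A_{[3]}^j\mathbf{u}_{\mu_k}:j\ge0\}$. Further $\lambda^\oplus_\vartriangle>0$, $\overline\omega\in\{0,\dots,\omega\}$ and indices $\overline\mu_1<\dots<\overline\mu_{\overline\omega}$ are such that $\Upsilon(\theta)\succeq\lambda^\oplus_\vartriangle\sum_{k=1}^{\overline\omega}E_{n,\overline\mu_k}$, and $\overline\delta_k:=\dim\operatorname{span}\{\boldsymbol\Phi_{D^\star}(\theta)^j\mathbf{u}_{\overline\mu_k}:j\ge0\}$. *)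

theory Defs
  imports "HOL-Analysis.Analysis"
begin

text \<open>Complex eigenvalues of a real square matrix.\<close>
definition cmat :: "real^'n^'n \<Rightarrow> complex^'n^'n" where
  "cmat A = (\<chi> i j. complex_of_real (A $ i $ j))"

definition is_eigenvalue :: "real^'n^'n \<Rightarrow> complex \<Rightarrow> bool" where
  "is_eigenvalue A z \<longleftrightarrow> (\<exists>v::complex^'n. v \<noteq> 0 \<and> cmat A *v v = z *s v)"

text \<open>The set CM-bar(n): all eigenvalues have modulus in (0,1).\<close>
definition CMbar :: "(real^'n^'n) set" where
  "CMbar = {A. \<forall>z. is_eigenvalue A z \<longrightarrow> 0 < cmod z \<and> cmod z < 1}"

definition pos_def :: "real^'n^'n \<Rightarrow> bool" where
  "pos_def A \<longleftrightarrow> transpose A = A \<and> (\<forall>x. x \<noteq> 0 \<longrightarrow> x \<bullet> (A *v x) > 0)"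

definition pos_semidef :: "real^'n^'n \<Rightarrow> bool" where
  "pos_semidef A \<longleftrightarrow> transpose A = A \<and> (\<forall>x. x \<bullet> (A *v x) \<ge> 0)"

text \<open>Loewner order: A \<succeq> B.\<close>
definition loewner_ge :: "real^'n^'n \<Rightarrow> real^'n^'n \<Rightarrow> bool" where
  "loewner_ge A B \<longleftrightarrow> pos_semidef (A - B)"

text \<open>E_{n,j}: diagonal matrix with a single 1 at (j,j).\<close>
definition Emat :: "'n \<Rightarrow> real^'n^'n" where
  "Emat j = (\<chi> i k. if i = j \<and> k = j then 1 else 0)"

text \<open>u_j: the j-th standard basis vector.\<close>
definition uvec :: "'n \<Rightarrow> real^'n" where
  "uvec j = axis j 1"

text \<open>dim span {A^j u : j \<ge> 0}.\<close>
definition krylov_dim :: "real^'n^'n \<Rightarrow> real^'n \<Rightarrow> nat" where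
  "krylov_dim A u = dim (span (range (\<lambda>j::nat. (((*v) A) ^^ j) u)))"

text \<open>Fundamental matrix of x' = D(t) x with Phi(0) = I.\<close>
definition fundamental_matrix :: "(real \<Rightarrow> real^'n^'n) \<Rightarrow> (real \<Rightarrow> real^'n^'n) \<Rightarrow> bool" where
  "fundamental_matrix D Phi \<longleftrightarrow> Phi 0 = mat 1 \<and>
     (\<forall>t\<ge>0. (Phi has_vector_derivative (D t ** Phi t)) (at t within {0..}))"

definition Upsilon :: "(real \<Rightarrow> real^'n^'n) \<Rightarrow> (real \<Rightarrow> real^'N^'n) \<Rightarrow> real \<Rightarrow> real^'n^'n" where
  "Upsilon Phi Lam t = integral {0..t}
     (\<lambda>s. let M = Phi t ** matrix_inv (Phi s) ** Lam s in M ** transpose M)"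

text \<open>Sigma^d_eps(0): the unique symmetric solution of the discrete Lyapunov equation.\<close>
definition Sigma_d0 :: "(real \<Rightarrow> real^'n^'n) \<Rightarrow> (real \<Rightarrow> real^'N^'n) \<Rightarrow> real \<Rightarrow> real \<Rightarrow> real^'n^'n" where
  "Sigma_d0 Phi Lam \<theta> \<epsilon> = (THE S. transpose S = S \<and>
     Phi \<theta> ** S ** transpose (Phi \<theta>) - S + \<epsilon> *\<^sub>R Upsilon Phi Lam \<theta> = 0)"

definition Sigma_d :: "(real \<Rightarrow> real^'n^'n) \<Rightarrow> (real \<Rightarrow> real^'N^'n) \<Rightarrow> real \<Rightarrow> real \<Rightarrow> real \<Rightarrow> real^'n^'n" where
  "Sigma_d Phi Lam \<theta> \<epsilon> t = Phi t ** Sigma_d0 Phi Lam \<theta> \<epsilon> ** transpose (Phi t) + \<epsilon> *\<^sub>R Upsilon Phi Lam t"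

end

theory Submission
  imports Defs "Jordan_Normal_Form.Spectral_Radius"
begin

text \<open>
  Write \<open>A = \<Phi>(\<theta>)\<close> and \<open>U = \<Upsilon>(\<theta>)\<close>. Since the spectrum of \<open>A\<close> lies in the open unit disc,
  \<open>A\<^sup>k \<rightarrow> 0\<close>; hence the discrete Lyapunov equation \<open>A S A\<^sup>T - S + \<epsilon> U = 0\<close> has a unique
  symmetric solution \<open>S = \<Sigma>\<^sup>d(0)\<close>, and telescoping gives
  \<open>x\<^sup>T S x = \<epsilon> \<Sum>\<^sub>k y\<^sub>k\<^sup>T U y\<^sub>k\<close> with \<open>y\<^sub>k = (A\<^sup>T)\<^sup>k x\<close>.
  Each of the four hypotheses makes some term of this series positive when \<open>x \<noteq> 0\<close>: either \<open>U\<close>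
  is positive definite, or \<open>U\<close> dominates a rank-one form \<open>(v\<^sup>T y)\<^sup>2\<close> whose direction \<open>v\<close> has
  a Krylov sequence \<open>A\<^sup>k v\<close> spanning the whole space, so that \<open>v\<^sup>T y\<^sub>k = x\<^sup>T A\<^sup>k v\<close> cannot vanish
  for all \<open>k\<close>. Finally \<open>\<Sigma>\<^sup>d(t) = \<Phi>(t) S \<Phi>(t)\<^sup>T + \<epsilon> \<Upsilon>(t)\<close> is positive definite because
  \<open>\<Phi>(t)\<close> is invertible and \<open>\<Upsilon>(t)\<close>, an integral of matrices \<open>M M\<^sup>T\<close>, is positive semidefinite.
\<close>

no_notation Matrix.vec_index (infixl "$" 100)
no_notation Matrix.scalar_prod (infix "\<bullet>" 70)
hide_const (open) Matrix.mat

section \<open>Matrix powers and elementary matrix algebra\<close>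

definition matpow :: "'a::semiring_1^'n^'n \<Rightarrow> nat \<Rightarrow> 'a^'n^'n" where
  "matpow A k = (((**) A) ^^ k) (mat 1)"

lemma matpow_0 [simp]: "matpow A 0 = mat 1"
  by (simp add: matpow_def)

lemma matpow_Suc: "matpow A (Suc k) = A ** matpow A k"
  by (simp add: matpow_def)

lemma matpow_Suc': "matpow A (Suc k) = matpow A k ** A"
  by (induction k) (simp_all add: matpow_Suc matrix_mul_assoc)

lemma matpow_scaleR: "matpow (c *\<^sub>R A) k = (c ^ k) *\<^sub>R matpow (A::real^'n^'n) k"
  by (induction k) (simp_all add: matpow_Suc matrix_scalar_ac scalar_matrix_assoc[symmetric])

lemma matpow_transpose: "matpow (transpose A) k = transpose (matpow (A::'a::comm_semiring_1^'n^'n) k)"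
  by (induction k) (simp_all add: matpow_Suc flip: matrix_transpose_mul matpow_Suc')

lemma matpow_orthogonal_conj:
  assumes H: "orthogonal_matrix H"
  shows "matpow (H ** A ** transpose H) k = H ** matpow A k ** transpose H"
proof (induction k)
  case 0
  then show ?case using H by (simp add: orthogonal_matrix_def)
next
  case (Suc k)
  have "matpow (H ** A ** transpose H) (Suc k) = H ** A ** (transpose H ** H) ** matpow A k ** transpose H"
    by (simp add: matpow_Suc Suc matrix_mul_assoc)
  also have "\<dots> = H ** matpow A (Suc k) ** transpose H"
    using H by (simp add: orthogonal_matrix_def matpow_Suc matrix_mul_assoc)
  finally show ?case .
qed

lemma iterate_matrix_vector_mult: "(((*v) A) ^^ k) v = matpow A k *v v"
  by (induction k) (simp_all add: matpow_Suc matrix_vector_mul_assoc)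

lemma matrix_add_rdistrib:
  fixes A B :: "'a::semiring_1^'m^'n" and C :: "'a^'k^'m"
  shows "(A + B) ** C = A ** C + B ** C"
  by (vector matrix_matrix_mult_def sum.distrib[symmetric] distrib_right)

lemma transpose_add: "transpose (A + B) = transpose A + transpose (B::'a::plus^'m^'n)"
  by (simp add: transpose_def Finite_Cartesian_Product.vec_eq_iff)

lemma transpose_diff: "transpose (A - B) = transpose A - transpose (B::'a::minus^'m^'n)"
  by (simp add: transpose_def Finite_Cartesian_Product.vec_eq_iff)

lemma transpose_zero [simp]: "transpose (0::'a::zero^'m^'n) = 0"
  by (simp add: transpose_def Finite_Cartesian_Product.vec_eq_iff)

lemma inner_matrix_vector_mult: "y \<bullet> (A *v x) = (transpose A *v y) \<bullet> (x::real^'m)"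
  by (simp add: dot_lmul_matrix)

lemma quadratic_form_congruence:
  "x \<bullet> ((A ** S ** transpose A) *v x) = (transpose A *v x) \<bullet> (S *v (transpose A *v x))"
  for x :: "real^'n"
  by (simp add: inner_matrix_vector_mult matrix_vector_mul_assoc[symmetric] del: transpose_matrix_vector)

lemma matrix_inv_orthogonal:
  assumes "orthogonal_matrix (H::real^'n^'n)"
  shows "matrix_inv H = transpose H"
  unfolding matrix_inv_def
proof (rule some_equality)
  show "H ** transpose H = mat 1 \<and> transpose H ** H = mat 1"
    using assms by (simp add: orthogonal_matrix_def)
next
  fix B assume "H ** B = mat 1 \<and> B ** H = mat 1"
  then show "B = transpose H"
    using assms by (metis matrix_mul_assoc matrix_mul_lid matrix_mul_rid orthogonal_matrix_def)
qed

lemma tendsto_matrix_matrix_mult: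
  fixes f :: "'a \<Rightarrow> 'b::real_normed_algebra_1^'m^'n" and g :: "'a \<Rightarrow> 'b^'k^'m"
  assumes "(f \<longlongrightarrow> A) F" "(g \<longlongrightarrow> B) F"
  shows "((\<lambda>x. f x ** g x) \<longlongrightarrow> A ** B) F"
proof (intro vec_tendstoI)
  show "((\<lambda>x. (f x ** g x) $ i $ j) \<longlongrightarrow> (A ** B) $ i $ j) F" for i j
    unfolding matrix_matrix_mult_def vec_lambda_beta by (intro tendsto_intros tendsto_vec_nth assms)
qed

lemma tendsto_matrix_vector_mult:
  fixes f :: "'a \<Rightarrow> 'b::real_normed_algebra_1^'m^'n" and g :: "'a \<Rightarrow> 'b^'m"
  assumes "(f \<longlongrightarrow> A) F" "(g \<longlongrightarrow> v) F"
  shows "((\<lambda>x. f x *v g x) \<longlongrightarrow> A *v v) F"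
proof (intro vec_tendstoI)
  show "((\<lambda>x. (f x *v g x) $ i) \<longlongrightarrow> (A *v v) $ i) F" for i
    unfolding matrix_vector_mult_def vec_lambda_beta by (intro tendsto_intros tendsto_vec_nth assms)
qed

lemma tendsto_transpose:
  fixes f :: "'a \<Rightarrow> 'b::real_normed_vector^'m^'n"
  assumes "(f \<longlongrightarrow> A) F"
  shows "((\<lambda>x. transpose (f x)) \<longlongrightarrow> transpose A) F"
proof (intro vec_tendstoI)
  show "((\<lambda>x. transpose (f x) $ i $ j) \<longlongrightarrow> transpose A $ i $ j) F" for i j
    unfolding transpose_def vec_lambda_beta by (intro tendsto_vec_nth assms)
qed

section \<open>Powers of a matrix with spectrum in the open unit disc\<close>

text \<open>Enumerating the index type by \<open>g\<close> turns a real matrix into a complex matrix of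
  Jordan_Normal_Form, where bounds on powers in terms of the spectral radius are available.\<close>

definition cart_to_mat :: "(nat \<Rightarrow> 'n) \<Rightarrow> real^'n^'n \<Rightarrow> complex Matrix.mat" where
  "cart_to_mat g (X::real^'n^'n) = Matrix.mat CARD('n) CARD('n) (\<lambda>(i,j). complex_of_real (X $ g i $ g j))"

lemma cart_to_mat_carrier [simp]:
  fixes X :: "real^'n^'n"
  shows "cart_to_mat g X \<in> carrier_mat CARD('n) CARD('n)"
    and "dim_row (cart_to_mat g X) = CARD('n)" and "dim_col (cart_to_mat g X) = CARD('n)"
  by (simp_all add: cart_to_mat_def)

lemma cart_to_mat_index [simp]:
  "i < CARD('n) \<Longrightarrow> j < CARD('n) \<Longrightarrow> cart_to_mat g X $$ (i,j) = complex_of_real (X $ g i $ g j)"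
  for X :: "real^'n^'n"
  by (simp add: cart_to_mat_def)

lemma cart_to_mat_mult:
  fixes X Y :: "real^'n^'n"
  assumes g: "bij_betw g {0..<CARD('n)} UNIV"
  shows "cart_to_mat g (X ** Y) = cart_to_mat g X * cart_to_mat g Y"
proof (rule eq_matI)
  fix i j
  assume "i < dim_row (cart_to_mat g X * cart_to_mat g Y)" "j < dim_col (cart_to_mat g X * cart_to_mat g Y)"
  then have ij: "i < CARD('n)" "j < CARD('n)" by auto
  have "(cart_to_mat g X * cart_to_mat g Y) $$ (i,j)
      = (\<Sum>l\<in>{0..<CARD('n)}. complex_of_real (X $ g i $ g l) * complex_of_real (Y $ g l $ g j))"
    using ij by (simp add: scalar_prod_def)
  also have "\<dots> = (\<Sum>c\<in>UNIV. complex_of_real (X $ g i $ c) * complex_of_real (Y $ c $ g j))"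
    by (rule sum.reindex_bij_betw[OF g])
  finally show "cart_to_mat g (X ** Y) $$ (i,j) = (cart_to_mat g X * cart_to_mat g Y) $$ (i,j)"
    using ij by (simp add: matrix_matrix_mult_def)
qed auto

lemma cart_to_mat_one:
  assumes g: "bij_betw g {0..<CARD('n)} (UNIV::'n set)"
  shows "cart_to_mat g (mat 1 :: real^'n^'n) = 1\<^sub>m CARD('n)"
proof (rule eq_matI)
  fix i j
  assume "i < dim_row (1\<^sub>m CARD('n) :: complex Matrix.mat)" "j < dim_col (1\<^sub>m CARD('n) :: complex Matrix.mat)"
  moreover from this have "g i = g j \<longleftrightarrow> i = j"
    using g by (auto simp: bij_betw_def inj_on_def)
  ultimately show "cart_to_mat g (mat 1 :: real^'n^'n) $$ (i, j) = 1\<^sub>m CARD('n) $$ (i, j)"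
    by (simp add: Finite_Cartesian_Product.mat_def)
qed auto

lemma cart_to_mat_matpow:
  fixes A :: "real^'n^'n"
  assumes g: "bij_betw g {0..<CARD('n)} (UNIV::'n set)"
  shows "cart_to_mat g (matpow A k) = cart_to_mat g A ^\<^sub>m k"
  by (induction k) (simp_all add: cart_to_mat_one[OF g] matpow_Suc' cart_to_mat_mult[OF g])

lemma cart_to_mat_scaleR: "cart_to_mat g (c *\<^sub>R X) = complex_of_real c \<cdot>\<^sub>m cart_to_mat g X"
  by (rule eq_matI) (auto simp: cart_to_mat_def)

lemma is_eigenvalue_if_eigenvalue_cart_to_mat:
  fixes A :: "real^'n^'n"
  assumes g: "bij_betw g {0..<CARD('n)} UNIV" and ev: "eigenvalue (cart_to_mat g A) e"
  shows "is_eigenvalue A e"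
proof -
  obtain v where v: "v \<in> carrier_vec CARD('n)" "v \<noteq> 0\<^sub>v CARD('n)" "cart_to_mat g A *\<^sub>v v = e \<cdot>\<^sub>v v"
    using ev unfolding eigenvalue_def eigenvector_def by auto
  define h where "h = inv_into {0..<CARD('n)} g"
  have h: "h a < CARD('n)" "g (h a) = a" for a
    using bij_betw_inv_into[OF g] bij_betw_inv_into_right[OF g] by (auto simp: h_def bij_betw_def)
  have hg: "h (g i) = i" if "i < CARD('n)" for i
    using bij_betw_inv_into_left[OF g] that by (simp add: h_def)
  define w :: "complex^'n" where "w = (\<chi> a. Matrix.vec_index v (h a))"
  have "w \<noteq> 0"
  proof
    assume w: "w = 0"
    have "v = 0\<^sub>v CARD('n)"
    proof (rule eq_vecI)
      fix i assume "i < dim_vec (0\<^sub>v CARD('n) :: complex Matrix.vec)"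
      then have "Matrix.vec_index v i = w $ g i" by (simp add: w_def hg)
      then show "Matrix.vec_index v i = Matrix.vec_index (0\<^sub>v CARD('n)) i"
        using w \<open>i < _\<close> by simp
    qed (use v(1) in simp)
    with v(2) show False ..
  qed
  moreover have "(cmat A *v w) $ a = (e *s w) $ a" for a
  proof -
    have "(\<Sum>c\<in>UNIV. complex_of_real (A $ a $ c) * Matrix.vec_index v (h c))
        = (\<Sum>l\<in>{0..<CARD('n)}. complex_of_real (A $ a $ g l) * Matrix.vec_index v (h (g l)))"
      by (rule sum.reindex_bij_betw[OF g, symmetric])
    also have "\<dots> = Matrix.vec_index (cart_to_mat g A *\<^sub>v v) (h a)"
      using v(1) h[of a] hg by (simp add: scalar_prod_def)
    also have "\<dots> = e * Matrix.vec_index v (h a)"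
      using v h[of a] by simp
    finally show ?thesis by (simp add: w_def cmat_def matrix_vector_mult_def)
  qed
  ultimately show ?thesis
    unfolding is_eigenvalue_def by (metis Finite_Cartesian_Product.vec_eq_iff)
qed

lemma eigenvalue_smult_mat:
  fixes M :: "'a::field Matrix.mat"
  assumes M: "M \<in> carrier_mat n n" and c: "c \<noteq> 0" and ev: "eigenvalue (c \<cdot>\<^sub>m M) e"
  shows "eigenvalue M (e / c)"
proof -
  obtain v where v: "v \<in> carrier_vec n" "v \<noteq> 0\<^sub>v n" "(c \<cdot>\<^sub>m M) *\<^sub>v v = e \<cdot>\<^sub>v v"
    using ev M unfolding eigenvalue_def eigenvector_def by auto
  have "M *\<^sub>v v = (e / c) \<cdot>\<^sub>v v"
  proof (rule eq_vecI)
    fix i assume "i < dim_vec ((e / c) \<cdot>\<^sub>v v)"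
    then have i: "i < n" using v by simp
    have "c * Matrix.vec_index (M *\<^sub>v v) i = Matrix.vec_index ((c \<cdot>\<^sub>m M) *\<^sub>v v) i"
      using M i v(1) by (auto simp: scalar_prod_def sum_distrib_left mult.assoc intro!: sum.cong)
    also have "\<dots> = e * Matrix.vec_index v i"
      using v(3) i v(1) by simp
    finally show "Matrix.vec_index (M *\<^sub>v v) i = Matrix.vec_index ((e / c) \<cdot>\<^sub>v v) i"
      using c i v(1) by (simp add: field_simps)
  qed (use M v in simp)
  with v M show ?thesis
    unfolding eigenvalue_def eigenvector_def by auto
qed

lemma spectral_radius_nonneg:
  assumes "M \<in> carrier_mat n n" and "n > 0"
  shows "0 \<le> spectral_radius M"
  using spectral_radius_mem_max(1)[OF assms] by auto

lemma spectral_radius_smult_le: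
  assumes M: "M \<in> carrier_mat n n" and n: "n > 0" and c: "c > 0"
  shows "spectral_radius (complex_of_real c \<cdot>\<^sub>m M) \<le> c * spectral_radius M"
proof -
  have cM: "complex_of_real c \<cdot>\<^sub>m M \<in> carrier_mat n n" using M by simp
  obtain e where e: "eigenvalue (complex_of_real c \<cdot>\<^sub>m M) e"
    and sr: "spectral_radius (complex_of_real c \<cdot>\<^sub>m M) = norm e"
    using spectral_radius_mem_max(1)[OF cM n] unfolding spectrum_def by auto
  have "eigenvalue M (e / complex_of_real c)"
    using eigenvalue_smult_mat[OF M _ e] c by simp
  then have "norm (e / complex_of_real c) \<le> spectral_radius M"
    by (intro spectral_radius_mem_max(2)[OF M n]) (auto simp: spectrum_def)
  then show ?thesis
    using c sr by (simp add: norm_divide divide_le_eq mult.commute)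
qed

lemma spectral_radius_cart_to_mat_less_1:
  fixes A :: "real^'n^'n"
  assumes g: "bij_betw g {0..<CARD('n)} UNIV" and A: "\<And>z. is_eigenvalue A z \<Longrightarrow> cmod z < 1"
  shows "spectral_radius (cart_to_mat g A) < 1"
proof -
  obtain e where "eigenvalue (cart_to_mat g A) e" "spectral_radius (cart_to_mat g A) = norm e"
    using spectral_radius_mem_max(1)[OF cart_to_mat_carrier(1)] unfolding spectrum_def by auto
  with is_eigenvalue_if_eigenvalue_cart_to_mat[OF g] A show ?thesis
    by simp
qed

text \<open>The powers of \<open>(1/r) A\<close>, whose spectral radius is below 1, are bounded.\<close>

lemma matpow_entries_geometric_bound:
  fixes A :: "real^'n^'n"
  assumes g: "bij_betw g {0..<CARD('n)} UNIV"
    and r: "spectral_radius (cart_to_mat g A) < r"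
  shows "\<exists>C. \<forall>k a b. \<bar>matpow A k $ a $ b\<bar> \<le> C * r ^ k"
proof -
  have r0: "r > 0"
    using r spectral_radius_nonneg[OF cart_to_mat_carrier(1)[of g A]] by simp
  define M where "M = cart_to_mat g ((1/r) *\<^sub>R A)"
  have "spectral_radius M \<le> 1/r * spectral_radius (cart_to_mat g A)"
    unfolding M_def cart_to_mat_scaleR using r0 by (intro spectral_radius_smult_le) auto
  also have "\<dots> < 1" using r r0 by (simp add: field_simps)
  finally obtain C where C: "\<forall>k. norm_bound (M ^\<^sub>m k) C"
    using spectral_radius_jnf_norm_bound_less_1_upper_triangular[OF cart_to_mat_carrier(1)]
    unfolding M_def by blast
  have bound: "\<bar>matpow A k $ g i $ g j\<bar> \<le> C * r ^ k" if ij: "i < CARD('n)" "j < CARD('n)" for k i j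
  proof -
    have "(M ^\<^sub>m k) $$ (i, j) = complex_of_real ((1/r) ^ k * matpow A k $ g i $ g j)"
      unfolding M_def cart_to_mat_matpow[OF g, symmetric] matpow_scaleR using ij by simp
    moreover have "norm ((M ^\<^sub>m k) $$ (i, j)) \<le> C"
      using C ij unfolding M_def norm_bound_def by simp
    ultimately have "\<bar>(1/r) ^ k * matpow A k $ g i $ g j\<bar> \<le> C"
      by (metis norm_of_real)
    then show ?thesis using r0 by (simp add: abs_mult power_one_over field_simps)
  qed
  have "\<bar>matpow A k $ a $ b\<bar> \<le> C * r ^ k" for k a b
  proof -
    obtain i j where "i < CARD('n)" "j < CARD('n)" "a = g i" "b = g j"
      using bij_betw_imp_surj_on[OF g] by (metis UNIV_I atLeastLessThan_iff imageE)
    then show ?thesis using bound by simp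
  qed
  then show ?thesis by blast
qed

theorem matpow_tendsto_zero:
  fixes A :: "real^'n^'n"
  assumes A: "\<And>z. is_eigenvalue A z \<Longrightarrow> cmod z < 1"
  shows "matpow A \<longlonglongrightarrow> 0"
proof -
  obtain g :: "nat \<Rightarrow> 'n" where g: "bij_betw g {0..<CARD('n)} UNIV"
    using ex_bij_betw_nat_finite[of "UNIV::'n set"] by auto
  define r where "r = (1 + spectral_radius (cart_to_mat g A)) / 2"
  have r: "spectral_radius (cart_to_mat g A) < r" "r < 1" "0 \<le> r"
    using spectral_radius_cart_to_mat_less_1[OF g A]
      spectral_radius_nonneg[OF cart_to_mat_carrier(1)[of g A]]
    unfolding r_def by auto
  then obtain C where C: "\<And>k a b. \<bar>matpow A k $ a $ b\<bar> \<le> C * r ^ k"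
    using matpow_entries_geometric_bound[OF g] by blast
  have "(\<lambda>k. C * r ^ k) \<longlonglongrightarrow> 0"
    using r by (intro tendsto_mult_right_zero LIMSEQ_power_zero) simp
  then have "(\<lambda>k. matpow A k $ a $ b) \<longlonglongrightarrow> 0" for a b
    by (rule Lim_null_comparison[rotated]) (simp add: C)
  then show ?thesis
    by (intro vec_tendstoI) simp
qed

section \<open>The discrete Lyapunov equation\<close>

lemma congruence_fixpoint_eq_zero:
  fixes A X :: "real^'n^'n"
  assumes decay: "matpow A \<longlonglongrightarrow> 0" and X: "A ** X ** transpose A = X"
  shows "X = 0"
proof -
  have X_eq: "matpow A k ** X ** transpose (matpow A k) = X" for k
  proof (induction k)
    case (Suc k)
    have "matpow A (Suc k) ** X ** transpose (matpow A (Suc k))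
        = A ** (matpow A k ** X ** transpose (matpow A k)) ** transpose A"
      by (simp add: matpow_Suc matrix_transpose_mul matrix_mul_assoc)
    then show ?case using Suc X by simp
  qed simp
  have "(\<lambda>k. matpow A k ** X ** transpose (matpow A k)) \<longlonglongrightarrow> 0 ** X ** transpose 0"
    by (intro tendsto_matrix_matrix_mult tendsto_transpose decay tendsto_const)
  then show ?thesis
    unfolding X_eq by (simp add: LIMSEQ_const_iff)
qed

text \<open>The map \<open>X \<mapsto> A X A\<^sup>T - X\<close> is injective by the previous lemma, hence bijective, and it
  commutes with transposition, so symmetrising any solution gives a symmetric one.\<close>

lemma lyapunov_equation_unique_symmetric_solution:
  fixes A U :: "real^'n^'n"
  assumes decay: "matpow A \<longlonglongrightarrow> 0" and U: "transpose U = U"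
  shows "\<exists>!S. transpose S = S \<and> A ** S ** transpose A - S + c *\<^sub>R U = 0"
proof -
  define L where "L X = A ** X ** transpose A - X" for X :: "real^'n^'n"
  have solves: "A ** S ** transpose A - S + c *\<^sub>R U = 0 \<longleftrightarrow> L S = (- c) *\<^sub>R U" for S
    by (simp add: L_def eq_neg_iff_add_eq_0)
  have lin: "linear L"
    unfolding L_def
    by (rule linearI) (simp_all add: matrix_add_ldistrib matrix_add_rdistrib matrix_scalar_ac
        scalar_matrix_assoc[symmetric] algebra_simps)
  have "inj L"
  proof (rule injI)
    fix X Y assume "L X = L Y"
    then have "A ** (X - Y) ** transpose A = X - Y"
      using linear_diff[OF lin, of X Y] by (simp add: L_def)
    then have "X - Y = 0" by (rule congruence_fixpoint_eq_zero[OF decay])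
    then show "X = Y" by simp
  qed
  then obtain X where X: "L X = (- c) *\<^sub>R U"
    using lin linear_inj_imp_surj by (metis surjD)
  have "L (transpose X) = transpose (L X)"
    unfolding L_def by (simp add: transpose_diff matrix_transpose_mul matrix_mul_assoc)
  then have XT: "L (transpose X) = (- c) *\<^sub>R U"
    by (simp only: X transpose_scalar U)
  define S where "S = (1/2) *\<^sub>R (X + transpose X)"
  have "L S = (1/2) *\<^sub>R ((- c) *\<^sub>R U + (- c) *\<^sub>R U)"
    unfolding S_def linear_scale[OF lin] linear_add[OF lin] X XT ..
  also have "\<dots> = (- c) *\<^sub>R U"
    by (simp only: scaleR_add_right scaleR_add_left[symmetric]) simp
  finally have LS: "L S = (- c) *\<^sub>R U" .
  have "transpose S = S"
    unfolding S_def by (simp add: transpose_scalar transpose_add add.commute)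
  then show ?thesis
    using LS \<open>inj L\<close> unfolding solves by (metis injD)
qed

lemma lyapunov_quadratic_form_telescope:
  fixes A S U :: "real^'n^'n" and x :: "real^'n"
  assumes S: "S = A ** S ** transpose A + c *\<^sub>R U"
  defines "y k \<equiv> matpow (transpose A) k *v x"
  shows "x \<bullet> (S *v x) = y m \<bullet> (S *v y m) + c * (\<Sum>k<m. y k \<bullet> (U *v y k))"
proof (induction m)
  case (Suc m)
  have y_Suc: "y (Suc m) = transpose A *v y m"
    by (simp add: y_def matpow_Suc matrix_vector_mul_assoc del: transpose_matrix_vector)
  have "y m \<bullet> (S *v y m) = y m \<bullet> ((A ** S ** transpose A + c *\<^sub>R U) *v y m)"
    using S by simp
  also have "\<dots> = y (Suc m) \<bullet> (S *v y (Suc m)) + c * (y m \<bullet> (U *v y m))"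
    unfolding y_Suc quadratic_form_congruence[symmetric]
    by (simp add: matrix_vector_mult_add_rdistrib inner_add_right scaleR_matrix_vector_assoc[symmetric])
  finally show ?case using Suc by (simp add: algebra_simps)
qed (simp add: y_def)

lemma lyapunov_solution_quadratic_lower_bound:
  fixes A S U :: "real^'n^'n" and x :: "real^'n"
  assumes decay: "matpow A \<longlonglongrightarrow> 0"
    and S: "A ** S ** transpose A - S + c *\<^sub>R U = 0"
    and c: "c \<ge> 0" and U: "pos_semidef U"
  defines "y k \<equiv> matpow (transpose A) k *v x"
  shows "c * (y k \<bullet> (U *v y k)) \<le> x \<bullet> (S *v x)"
proof -
  have S': "S = A ** S ** transpose A + c *\<^sub>R U" using S by (simp add: algebra_simps)
  have "y \<longlonglongrightarrow> transpose 0 *v x"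
    unfolding y_def matpow_transpose by (intro tendsto_matrix_vector_mult tendsto_transpose decay tendsto_const)
  then have "(\<lambda>m. y m \<bullet> (S *v y m)) \<longlonglongrightarrow> 0 \<bullet> (S *v 0)"
    by (intro tendsto_intros tendsto_matrix_vector_mult) simp_all
  moreover have "y m \<bullet> (S *v y m) \<le> x \<bullet> (S *v x) - c * (y k \<bullet> (U *v y k))" if "Suc k \<le> m" for m
  proof -
    have "y k \<bullet> (U *v y k) \<le> (\<Sum>j<m. y j \<bullet> (U *v y j))"
      using that U by (intro member_le_sum) (auto simp: pos_semidef_def)
    then have "c * (y k \<bullet> (U *v y k)) \<le> c * (\<Sum>j<m. y j \<bullet> (U *v y j))"
      by (rule mult_left_mono[OF _ c])
    then show ?thesis
      using lyapunov_quadratic_form_telescope[OF S', of x m] unfolding y_def by linarith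
  qed
  ultimately have "0 \<le> x \<bullet> (S *v x) - c * (y k \<bullet> (U *v y k))"
    by (intro LIMSEQ_le_const2) auto
  then show ?thesis by simp
qed

text \<open>For \<open>U = B B\<^sup>T\<close> this is controllability of the pair \<open>(A, B)\<close>: no \<open>x \<noteq> 0\<close> is
  orthogonal to all columns of all \<open>A\<^sup>k B\<close>.\<close>

definition lyapunov_controllable :: "real^'n^'n \<Rightarrow> real^'n^'n \<Rightarrow> bool" where
  "lyapunov_controllable A U \<longleftrightarrow>
     (\<forall>x. x \<noteq> 0 \<longrightarrow> (\<exists>k. let y = matpow (transpose A) k *v x in 0 < y \<bullet> (U *v y)))"

lemma pos_def_lyapunov_solution:
  fixes A S U :: "real^'n^'n"
  assumes decay: "matpow A \<longlonglongrightarrow> 0" and sym: "transpose S = S"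
    and S: "A ** S ** transpose A - S + c *\<^sub>R U = 0"
    and c: "c > 0" and U: "pos_semidef U" and ctrl: "lyapunov_controllable A U"
  shows "pos_def S"
  unfolding pos_def_def
proof (intro conjI allI impI sym)
  fix x :: "real^'n" assume "x \<noteq> 0"
  then obtain k where k: "0 < (matpow (transpose A) k *v x) \<bullet> (U *v (matpow (transpose A) k *v x))"
    using ctrl unfolding lyapunov_controllable_def Let_def by blast
  have "0 < c * ((matpow (transpose A) k *v x) \<bullet> (U *v (matpow (transpose A) k *v x)))"
    using c k by simp
  also have "\<dots> \<le> x \<bullet> (S *v x)"
    using c by (intro lyapunov_solution_quadratic_lower_bound[OF decay S _ U]) simp
  finally show "0 < x \<bullet> (S *v x)" .
qed

section \<open>Sufficient conditions for controllability\<close>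

text \<open>If \<open>U x \<noteq> 0\<close>, the form is negative at \<open>x - t U x\<close> for small \<open>t > 0\<close>.\<close>

lemma pos_semidef_quadratic_form_eq_zero:
  fixes U :: "real^'n^'n"
  assumes U: "pos_semidef U" and x: "x \<bullet> (U *v x) = 0"
  shows "U *v x = 0"
proof (rule ccontr)
  assume "U *v x \<noteq> 0"
  define y where "y = U *v x"
  define a where "a = y \<bullet> y"
  define b where "b = y \<bullet> (U *v y)"
  define t where "t = a / (b + 1)"
  have a: "a > 0" using \<open>U *v x \<noteq> 0\<close> by (simp add: a_def y_def)
  have b: "b \<ge> 0" using U by (simp add: b_def pos_semidef_def)
  have t: "t > 0" "t * b \<le> a" using a b by (simp_all add: t_def field_simps)
  have xy: "x \<bullet> (U *v y) = a"
    using U inner_matrix_vector_mult[of x U y] by (simp add: a_def y_def inner_commute pos_semidef_def)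
  have "0 \<le> (x - t *\<^sub>R y) \<bullet> (U *v (x - t *\<^sub>R y))"
    using U by (simp add: pos_semidef_def)
  also have "\<dots> = x \<bullet> (U *v x) - t * (x \<bullet> (U *v y)) - t * (y \<bullet> (U *v x)) + t * t * b"
    by (simp add: b_def matrix_vector_mult_diff_distrib scaleR_matrix_vector_assoc[symmetric]
        inner_diff_left inner_diff_right algebra_simps)
  also have "\<dots> = t * (t * b - 2 * a)"
    using x xy by (simp add: a_def y_def algebra_simps)
  finally have "0 \<le> t * b - 2 * a" using t by (simp add: zero_le_mult_iff)
  with a t show False by linarith
qed

lemma pos_def_if_pos_semidef_full_rank:
  fixes U :: "real^'n^'n"
  assumes U: "pos_semidef U" and rank: "rank U = CARD('n)"
  shows "pos_def U"
  unfolding pos_def_def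
proof (intro conjI allI impI)
  show "transpose U = U" using U by (simp add: pos_semidef_def)
  fix x :: "real^'n" assume "x \<noteq> 0"
  then have "U *v x \<noteq> 0"
    using rank by (metis full_rank_injective injD matrix_vector_mult_0_right)
  then show "0 < x \<bullet> (U *v x)"
    using U pos_semidef_quadratic_form_eq_zero by (fastforce simp: pos_semidef_def order_le_less)
qed

lemma quadratic_form_Emat: "y \<bullet> (Emat j *v y) = (y $ j)\<^sup>2"
proof -
  have "Emat j *v y = axis j (y $ j)"
    by (simp add: Emat_def axis_def matrix_vector_mult_def Finite_Cartesian_Product.vec_eq_iff
        if_distrib if_distribR sum.delta cong: if_cong)
  then show ?thesis by (simp add: inner_axis power2_eq_square)
qed

lemma quadratic_form_sum_Emat:
  fixes y :: "real^'n" and f :: "'k \<Rightarrow> 'n"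
  shows "y \<bullet> ((\<Sum>k\<in>K. c k *\<^sub>R Emat (f k)) *v y) = (\<Sum>k\<in>K. c k * (y $ f k)\<^sup>2)"
proof -
  have "linear (\<lambda>M::real^'n^'n. y \<bullet> (M *v y))"
    by (rule linearI) (simp_all add: matrix_vector_mult_add_rdistrib inner_add_right
        scaleR_matrix_vector_assoc[symmetric])
  from linear_sum[OF this, of "\<lambda>k. c k *\<^sub>R Emat (f k)" K]
  show ?thesis
    by (simp add: quadratic_form_Emat scaleR_matrix_vector_assoc[symmetric])
qed

lemma sum_Emat_bij_eq_mat_1:
  assumes "inj_on f {1..CARD('n)}"
  shows "(\<Sum>k\<in>{1..CARD('n)}. Emat (f k)) = (mat 1 :: real^'n^'n)"
proof -
  have "f ` {1..CARD('n)} = UNIV"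
    using assms by (intro card_subset_eq) (auto simp: card_image)
  then have "(\<Sum>k\<in>{1..CARD('n)}. Emat (f k)) = (\<Sum>j\<in>UNIV. Emat j :: real^'n^'n)"
    using sum.reindex[OF assms, of Emat] by simp
  also have "\<dots> = mat 1"
    by (auto simp: Emat_def Finite_Cartesian_Product.mat_def Finite_Cartesian_Product.vec_eq_iff
        sum_component intro: sum.neutral)
  finally show ?thesis .
qed

lemma loewner_ge_quadratic_form:
  assumes "loewner_ge U V"
  shows "y \<bullet> (V *v y) \<le> y \<bullet> (U *v (y::real^'n))"
  using assms
  by (simp add: loewner_ge_def pos_semidef_def matrix_vector_mult_diff_rdistrib inner_diff_right)

lemma pos_def_if_loewner_ge_identity:
  assumes c: "c > 0" and U: "loewner_ge U (c *\<^sub>R mat 1)"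
  shows "pos_def (U::real^'n^'n)"
  unfolding pos_def_def
proof (intro conjI allI impI)
  have "transpose (U - c *\<^sub>R mat 1) = U - c *\<^sub>R mat 1"
    using U by (simp add: loewner_ge_def pos_semidef_def)
  then show "transpose U = U"
    by (simp add: transpose_diff transpose_scalar)
  fix x :: "real^'n" assume "x \<noteq> 0"
  then have "0 < x \<bullet> ((c *\<^sub>R mat 1) *v x)"
    using c by (simp add: scaleR_matrix_vector_assoc[symmetric])
  also have "\<dots> \<le> x \<bullet> (U *v x)" by (rule loewner_ge_quadratic_form[OF U])
  finally show "0 < x \<bullet> (U *v x)" .
qed

lemma loewner_ge_sum_Emat_quadratic_bound:
  assumes U: "loewner_ge U (c *\<^sub>R (\<Sum>k\<in>K. Emat (f k)))"
    and c: "c \<ge> 0" and K: "finite K" "k \<in> K"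
  shows "c * (uvec (f k) \<bullet> y)\<^sup>2 \<le> y \<bullet> (U *v (y::real^'n))"
proof -
  have "c * (uvec (f k) \<bullet> y)\<^sup>2 = c * (y $ f k)\<^sup>2"
    by (simp add: uvec_def inner_axis')
  also have "\<dots> \<le> (\<Sum>i\<in>K. c * (y $ f i)\<^sup>2)"
    using K c by (intro member_le_sum) auto
  also have "\<dots> = y \<bullet> ((c *\<^sub>R (\<Sum>i\<in>K. Emat (f i))) *v y)"
    by (simp add: scaleR_sum_right quadratic_form_sum_Emat)
  also have "\<dots> \<le> y \<bullet> (U *v y)" by (rule loewner_ge_quadratic_form[OF U])
  finally show ?thesis .
qed

lemma orthogonal_diagonalization_quadratic_bound:
  fixes U H :: "real^'n^'n"
  assumes H: "orthogonal_matrix H"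
    and HU: "H ** U ** transpose H = (\<Sum>k\<in>K. c k *\<^sub>R Emat (f k))"
    and c: "\<forall>k\<in>K. c k \<ge> 0" and K: "finite K" "k \<in> K"
  shows "c k * ((transpose H *v uvec (f k)) \<bullet> y)\<^sup>2 \<le> y \<bullet> (U *v y)"
proof -
  have "transpose H *v (H *v y) = y"
    using H by (simp add: matrix_vector_mul_assoc orthogonal_matrix_def del: transpose_matrix_vector)
  then have "y \<bullet> (U *v y) = (H *v y) \<bullet> ((H ** U ** transpose H) *v (H *v y))"
    by (simp only: quadratic_form_congruence)
  also have "\<dots> = (\<Sum>i\<in>K. c i * ((H *v y) $ f i)\<^sup>2)"
    unfolding HU quadratic_form_sum_Emat ..
  finally have "y \<bullet> (U *v y) = (\<Sum>i\<in>K. c i * ((H *v y) $ f i)\<^sup>2)" .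
  moreover have "(transpose H *v uvec (f k)) \<bullet> y = (H *v y) $ f k"
  proof -
    have "(transpose H *v uvec (f k)) \<bullet> y = (H *v y) \<bullet> uvec (f k)"
      by (simp only: inner_commute[of _ y] inner_matrix_vector_mult Finite_Cartesian_Product.transpose_transpose)
    then show ?thesis by (simp add: uvec_def inner_axis)
  qed
  moreover have "c k * ((H *v y) $ f k)\<^sup>2 \<le> (\<Sum>i\<in>K. c i * ((H *v y) $ f i)\<^sup>2)"
    using K c by (intro member_le_sum) auto
  ultimately show ?thesis by simp
qed

lemma krylov_dim_orthogonal_conj:
  fixes A H :: "real^'n^'n"
  assumes H: "orthogonal_matrix H"
  shows "krylov_dim (H ** A ** transpose H) u = krylov_dim A (transpose H *v u)"
proof -
  have "(\<lambda>j. matpow (H ** A ** transpose H) j *v u)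
      = (*v) H \<circ> (\<lambda>j. matpow A j *v (transpose H *v u))"
    by (simp add: fun_eq_iff matpow_orthogonal_conj[OF H] matrix_vector_mul_assoc matrix_mul_assoc
        del: transpose_matrix_vector)
  then have "range (\<lambda>j. matpow (H ** A ** transpose H) j *v u)
      = (*v) H ` range (\<lambda>j. matpow A j *v (transpose H *v u))"
    by (simp only: image_comp)
  moreover have "inj ((*v) H)"
    using H by (metis inj_matrix_vector_mult invertible_def orthogonal_matrix_def)
  ultimately show ?thesis
    unfolding krylov_dim_def iterate_matrix_vector_mult dim_span
    by (simp add: dim_image_eq inj_on_subset)
qed

lemma krylov_dim_full_imp_inner_nonzero:
  fixes A :: "real^'n^'n"
  assumes full: "krylov_dim A v = CARD('n)" and x: "x \<noteq> 0"
  obtains m where "x \<bullet> (matpow A m *v v) \<noteq> 0"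
proof (rule ccontr)
  assume "\<not> thesis"
  with that have orth: "\<forall>m. x \<bullet> (matpow A m *v v) = 0" by blast
  define B where "B = range (\<lambda>m. matpow A m *v v)"
  have "dim B = CARD('n)"
    using full unfolding krylov_dim_def iterate_matrix_vector_mult dim_span B_def .
  then have "x \<in> span B"
    using dim_eq_full[of B] by simp
  then have "x \<bullet> x = 0"
    using orth orthogonal_to_span[of x B x] by (auto simp: B_def Linear_Algebra.orthogonal_def)
  with x show False by simp
qed

lemma lyapunov_controllable_if_pos_def:
  assumes "pos_def U"
  shows "lyapunov_controllable A U"
  using assms unfolding lyapunov_controllable_def pos_def_def
  by (metis matpow_0 matrix_vector_mul_lid)

lemma lyapunov_controllable_if_krylov:
  fixes A U :: "real^'n^'n"
  assumes c: "c > 0" and U: "\<And>y. c * (v \<bullet> y)\<^sup>2 \<le> y \<bullet> (U *v y)"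
    and full: "krylov_dim A v = CARD('n)"
  shows "lyapunov_controllable A U"
  unfolding lyapunov_controllable_def Let_def
proof (intro allI impI)
  fix x :: "real^'n" assume "x \<noteq> 0"
  then obtain m where "x \<bullet> (matpow A m *v v) \<noteq> 0"
    using krylov_dim_full_imp_inner_nonzero[OF full] by blast
  moreover have "x \<bullet> (matpow A m *v v) = (matpow (transpose A) m *v x) \<bullet> v"
    by (simp only: inner_matrix_vector_mult matpow_transpose)
  ultimately have "0 < c * (v \<bullet> (matpow (transpose A) m *v x))\<^sup>2"
    using c by (simp add: inner_commute)
  then show "\<exists>k. 0 < (matpow (transpose A) k *v x) \<bullet> (U *v (matpow (transpose A) k *v x))"
    using U by (meson order_less_le_trans)
qed

lemma lyapunov_controllable_if_full_rank:
  fixes A U :: "real^'n^'n"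
  assumes "pos_semidef U" and "rank U = CARD('n)"
  shows "lyapunov_controllable A U"
  using assms by (intro lyapunov_controllable_if_pos_def pos_def_if_pos_semidef_full_rank)

lemma lyapunov_controllable_if_orthogonal_diagonalization_krylov:
  fixes A U H :: "real^'n^'n"
  assumes H: "orthogonal_matrix H"
    and HU: "H ** U ** transpose H = (\<Sum>i\<in>K. c i *\<^sub>R Emat (f i))"
    and c: "\<forall>i\<in>K. c i > 0" and K: "finite K" "k \<in> K"
    and full: "krylov_dim (H ** A ** matrix_inv H) (uvec (f k)) = CARD('n)"
  shows "lyapunov_controllable A U"
proof (rule lyapunov_controllable_if_krylov)
  show "0 < c k" using c K by blast
  show "c k * ((transpose H *v uvec (f k)) \<bullet> y)\<^sup>2 \<le> y \<bullet> (U *v y)" for y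
    using c K by (intro orthogonal_diagonalization_quadratic_bound[OF H HU]) auto
  show "krylov_dim A (transpose H *v uvec (f k)) = CARD('n)"
    using full by (simp add: matrix_inv_orthogonal[OF H] krylov_dim_orthogonal_conj[OF H]
        del: transpose_matrix_vector)
qed

lemma lyapunov_controllable_if_loewner_ge_coordinates:
  fixes A U :: "real^'n^'n"
  assumes c: "c > 0" and f: "inj_on f {1..CARD('n)}"
    and U: "loewner_ge U (c *\<^sub>R (\<Sum>k\<in>{1..CARD('n)}. Emat (f k)))"
  shows "lyapunov_controllable A U"
  using U unfolding sum_Emat_bij_eq_mat_1[OF f]
  by (intro lyapunov_controllable_if_pos_def pos_def_if_loewner_ge_identity[OF c])

lemma lyapunov_controllable_if_loewner_ge_krylov:
  fixes A U :: "real^'n^'n"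
  assumes c: "c > 0" and U: "loewner_ge U (c *\<^sub>R (\<Sum>i\<in>K. Emat (f i)))"
    and K: "finite K" "k \<in> K" and full: "krylov_dim A (uvec (f k)) = CARD('n)"
  shows "lyapunov_controllable A U"
  using c K
  by (intro lyapunov_controllable_if_krylov[OF c _ full] loewner_ge_sum_Emat_quadratic_bound[OF U]) auto

section \<open>Invertibility of the fundamental matrix\<close>

lemma quadratic_form_abs_le_norm:
  fixes M :: "real^'n^'n"
  shows "\<bar>y \<bullet> (M *v y)\<bar> \<le> (real CARD('n) * real CARD('n) * norm M) * (y \<bullet> y)"
proof -
  have "\<bar>M $ i $ j\<bar> \<le> norm M" for i j
    by (rule order_trans[OF component_le_norm_cart Finite_Cartesian_Product.norm_nth_le])
  then have on: "onorm ((*v) M) \<le> real CARD('n) * real CARD('n) * norm M"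
    by (rule onorm_le_matrix_component)
  have "\<bar>y \<bullet> (M *v y)\<bar> \<le> norm y * norm (M *v y)" by (rule Cauchy_Schwarz_ineq2)
  also have "\<dots> \<le> norm y * (onorm ((*v) M) * norm y)"
    by (intro mult_left_mono onorm matrix_vector_mul_bounded_linear) simp
  also have "\<dots> \<le> norm y * ((real CARD('n) * real CARD('n) * norm M) * norm y)"
    by (intro mult_left_mono mult_right_mono on) auto
  finally show ?thesis
    by (simp add: power2_norm_eq_inner[symmetric] power2_eq_square mult_ac)
qed

lemma continuous_quadratic_form_bound:
  fixes D :: "real \<Rightarrow> real^'n^'n"
  assumes "continuous_on S D" and "compact S"
  obtains C where "\<And>s y. s \<in> S \<Longrightarrow> \<bar>y \<bullet> (D s *v y)\<bar> \<le> C * (y \<bullet> y)"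
proof -
  have "bounded (D ` S)"
    using assms by (intro compact_imp_bounded compact_continuous_image)
  then obtain B where B: "\<And>s. s \<in> S \<Longrightarrow> norm (D s) \<le> B"
    unfolding bounded_iff by blast
  have "\<bar>y \<bullet> (D s *v y)\<bar> \<le> (real CARD('n) * real CARD('n) * B) * (y \<bullet> y)" if "s \<in> S" for s y
  proof -
    have "real CARD('n) * real CARD('n) * norm (D s) * (y \<bullet> y) \<le> real CARD('n) * real CARD('n) * B * (y \<bullet> y)"
      using B[OF that] by (intro mult_right_mono mult_left_mono) simp_all
    then show ?thesis
      using quadratic_form_abs_le_norm[of y "D s"] by linarith
  qed
  then show ?thesis by (rule that)
qed

lemma decay_at_most_exponential:
  fixes f f' :: "real \<Rightarrow> real"
  assumes t: "0 \<le> t" and cont: "continuous_on {0..t} f"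
    and deriv: "\<And>s. 0 < s \<Longrightarrow> s < t \<Longrightarrow> (f has_real_derivative f' s) (at s)"
    and lower: "\<And>s. 0 < s \<Longrightarrow> s < t \<Longrightarrow> - K * f s \<le> f' s"
  shows "f 0 \<le> exp (K * t) * f t"
proof -
  have "exp (K * 0) * f 0 \<le> exp (K * t) * f t"
  proof (rule DERIV_nonneg_imp_increasing_open[OF t _ continuous_on_mult[OF _ cont]])
    fix s assume s: "0 < s" "s < t"
    have "((\<lambda>s. exp (K * s) * f s) has_real_derivative exp (K * s) * (K * f s + f' s)) (at s)"
      by (auto intro!: derivative_eq_intros deriv[OF s] simp: algebra_simps)
    moreover have "0 \<le> exp (K * s) * (K * f s + f' s)"
      using lower[OF s] by simp
    ultimately show "\<exists>y. ((\<lambda>s. exp (K * s) * f s) has_real_derivative y) (at s) \<and> 0 \<le> y"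
      by blast
  qed (intro continuous_intros)
  then show ?thesis by simp
qed

lemma fundamental_matrix_quadratic_derivative:
  fixes D Phi :: "real \<Rightarrow> real^'n^'n" and v :: "real^'n"
  assumes fund: "fundamental_matrix D Phi" and s: "s \<ge> 0"
  defines "x \<equiv> \<lambda>s. Phi s *v v"
  shows "((\<lambda>s. x s \<bullet> x s) has_real_derivative 2 * (x s \<bullet> (D s *v x s))) (at s within {0..})"
proof -
  have bl: "bounded_linear (\<lambda>M::real^'n^'n. M *v v)"
    by (simp add: linear_conv_bounded_linear[symmetric] linearI matrix_vector_mult_add_rdistrib
        scaleR_matrix_vector_assoc[symmetric])
  have "(Phi has_derivative (\<lambda>h. h *\<^sub>R (D s ** Phi s))) (at s within {0..})"
    using fund s unfolding fundamental_matrix_def has_vector_derivative_def by blast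
  then have "(x has_derivative (\<lambda>h. h *\<^sub>R (D s *v x s))) (at s within {0..})"
    unfolding x_def using bounded_linear.has_derivative[OF bl]
    by (simp add: scaleR_matrix_vector_assoc matrix_vector_mul_assoc)
  from has_derivative_inner[OF this this] show ?thesis
    unfolding has_field_derivative_def
    by (rule has_derivative_eq_rhs) (simp add: fun_eq_iff inner_commute algebra_simps)
qed

text \<open>Backward uniqueness: \<open>|\<Phi>(s) v|\<^sup>2\<close> decays at most exponentially, so it cannot reach zero.\<close>

lemma fundamental_matrix_kernel_trivial:
  fixes D Phi :: "real \<Rightarrow> real^'n^'n"
  assumes D_cont: "continuous_on {0..} D" and fund: "fundamental_matrix D Phi"
    and t: "t \<ge> 0" and v: "Phi t *v v = 0"
  shows "v = 0"
proof -
  define x where "x s = Phi s *v v" for s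
  define f where "f s = x s \<bullet> x s" for s
  have "continuous_on {0..t} D"
    using D_cont by (rule continuous_on_subset) auto
  then obtain C where C: "\<And>s y. s \<in> {0..t} \<Longrightarrow> \<bar>y \<bullet> (D s *v y)\<bar> \<le> C * (y \<bullet> y)"
    using continuous_quadratic_form_bound[OF _ compact_Icc] by blast
  have deriv: "(f has_real_derivative 2 * (x s \<bullet> (D s *v x s))) (at s within {0..})" if "s \<ge> 0" for s
    unfolding f_def x_def by (rule fundamental_matrix_quadratic_derivative[OF fund that])
  then have "continuous_on {0..} f"
    by (auto simp: continuous_on_eq_continuous_within intro: DERIV_continuous)
  then have "continuous_on {0..t} f"
    by (rule continuous_on_subset) auto
  moreover have "(f has_real_derivative 2 * (x s \<bullet> (D s *v x s))) (at s)" if "0 < s" for s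
  proof -
    have "at s within {0..} = at s"
      by (rule at_within_interior) (simp add: that)
    with deriv[of s] that show ?thesis by simp
  qed
  moreover have "- (2 * C) * f s \<le> 2 * (x s \<bullet> (D s *v x s))" if "s \<in> {0..t}" for s
    using C[OF that, of "x s"] by (simp add: f_def abs_le_iff)
  ultimately have "f 0 \<le> exp (2 * C * t) * f t"
    using t by (intro decay_at_most_exponential) auto
  moreover have "f t = 0" and "f 0 = v \<bullet> v"
    using v fund by (simp_all add: f_def x_def fundamental_matrix_def)
  ultimately have "v \<bullet> v \<le> 0" by simp
  then show ?thesis by (metis inner_gt_zero_iff not_le)
qed

lemma fundamental_matrix_invertible:
  fixes D Phi :: "real \<Rightarrow> real^'n^'n"
  assumes "continuous_on {0..} D" and "fundamental_matrix D Phi" and "t \<ge> 0"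
  shows "invertible (Phi t)"
proof -
  have "inj ((*v) (Phi t))"
  proof (rule injI)
    fix u w assume "Phi t *v u = Phi t *v w"
    then have "Phi t *v (u - w) = 0" by (simp add: matrix_vector_mult_diff_distrib)
    then have "u - w = 0" by (rule fundamental_matrix_kernel_trivial[OF assms])
    then show "u = w" by simp
  qed
  then obtain B where "B ** Phi t = mat 1"
    using matrix_left_invertible_injective by blast
  then show ?thesis
    using matrix_left_right_inverse unfolding invertible_def by blast
qed

section \<open>Positive definiteness of the covariance\<close>

lemma pos_semidef_mult_transpose: "pos_semidef (M ** transpose M)"
  for M :: "real^'m^'n"
proof -
  have "y \<bullet> ((M ** transpose M) *v y) = (transpose M *v y) \<bullet> (transpose M *v y)" for y
    by (simp add: inner_matrix_vector_mult matrix_vector_mul_assoc[symmetric] del: transpose_matrix_vector)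
  then show ?thesis
    by (simp add: pos_semidef_def matrix_transpose_mul)
qed

lemma pos_semidef_integral:
  fixes F :: "real \<Rightarrow> real^'n^'n"
  assumes "\<And>s. s \<in> S \<Longrightarrow> pos_semidef (F s)"
  shows "pos_semidef (integral S F)"
proof (cases "F integrable_on S")
  case True
  have bl_transpose: "bounded_linear (transpose :: real^'n^'n \<Rightarrow> _)"
    by (simp add: linear_conv_bounded_linear[symmetric] linearI transpose_add transpose_scalar)
  have bl_quad: "bounded_linear (\<lambda>M::real^'n^'n. x \<bullet> (M *v x))" for x
    by (simp add: linear_conv_bounded_linear[symmetric] linearI matrix_vector_mult_add_rdistrib
        inner_add_right scaleR_matrix_vector_assoc[symmetric])
  have "transpose (integral S F) = integral S (\<lambda>s. transpose (F s))"
    using integral_linear[OF True bl_transpose] by (simp add: o_def)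
  also have "\<dots> = integral S F"
    using assms by (intro integral_cong) (simp add: pos_semidef_def)
  finally have "transpose (integral S F) = integral S F" .
  moreover have "0 \<le> x \<bullet> (integral S F *v x)" for x
  proof -
    have "x \<bullet> (integral S F *v x) = integral S (\<lambda>s. x \<bullet> (F s *v x))"
      using integral_linear[OF True bl_quad] by (simp add: o_def)
    also have "\<dots> \<ge> 0"
      using integrable_linear[OF True bl_quad] assms
      by (intro integral_nonneg) (auto simp: o_def pos_semidef_def)
    finally show ?thesis .
  qed
  ultimately show ?thesis by (simp add: pos_semidef_def)
next
  case False
  then show ?thesis by (simp add: not_integrable_integral pos_semidef_def)
qed

lemma pos_semidef_Upsilon: "pos_semidef (Upsilon Phi Lam t)"
  unfolding Upsilon_def Let_def by (intro pos_semidef_integral pos_semidef_mult_transpose)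

lemma pos_def_congruence_add_pos_semidef:
  fixes S P V :: "real^'n^'n"
  assumes S: "pos_def S" and P: "invertible P" and V: "pos_semidef V" and c: "c \<ge> 0"
  shows "pos_def (P ** S ** transpose P + c *\<^sub>R V)"
  unfolding pos_def_def
proof (intro conjI allI impI)
  show "transpose (P ** S ** transpose P + c *\<^sub>R V) = P ** S ** transpose P + c *\<^sub>R V"
    using S V by (simp add: pos_def_def pos_semidef_def transpose_add transpose_scalar
        matrix_transpose_mul matrix_mul_assoc)
  fix x :: "real^'n" assume "x \<noteq> 0"
  then have "transpose P *v x \<noteq> 0"
    using P by (metis inj_matrix_vector_mult injD matrix_vector_mult_0_right transpose_invertible)
  then have "0 < x \<bullet> ((P ** S ** transpose P) *v x)"
    using S by (simp add: quadratic_form_congruence pos_def_def del: transpose_matrix_vector)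
  also have "\<dots> \<le> x \<bullet> ((P ** S ** transpose P + c *\<^sub>R V) *v x)"
    using V c by (simp add: matrix_vector_mult_add_rdistrib inner_add_right pos_semidef_def
        scaleR_matrix_vector_assoc[symmetric])
  finally show "0 < x \<bullet> ((P ** S ** transpose P + c *\<^sub>R V) *v x)" .
qed

theorem corollary4p1:
  fixes D :: "real \<Rightarrow> real^'n^'n"
    and Lam :: "real \<Rightarrow> real^('N::finite)^'n"
    and Phi :: "real \<Rightarrow> real^'n^'n"
    and \<theta> \<epsilon> :: real
  assumes theta_pos: "\<theta> > 0"
    and eps_pos: "\<epsilon> > 0"
    and D_cont: "continuous_on {0..} D"
    and Lam_cont: "continuous_on {0..} Lam"
    and D_per: "\<forall>t\<ge>0. D (t + \<theta>) = D t"
    and Lam_per: "\<forall>t\<ge>0. Lam (t + \<theta>) = Lam t"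
    and fund: "fundamental_matrix D Phi"
    and CM: "Phi \<theta> \<in> CMbar"
    and cases:
      "rank (Upsilon Phi Lam \<theta>) = CARD('n)
       \<or> (\<exists>H lam mu k. orthogonal_matrix H
            \<and> H ** Upsilon Phi Lam \<theta> ** transpose H
                = (\<Sum>k'\<in>{1..rank (Upsilon Phi Lam \<theta>)}. lam k' *\<^sub>R Emat (mu k'))
            \<and> (\<forall>k'\<in>{1..rank (Upsilon Phi Lam \<theta>)}. lam k' > (0::real))
            \<and> inj_on mu {1..rank (Upsilon Phi Lam \<theta>)}
            \<and> k \<in> {1..rank (Upsilon Phi Lam \<theta>)}
            \<and> krylov_dim (H ** Phi \<theta> ** matrix_inv H) (uvec (mu k)) = CARD('n))
       \<or> (\<exists>lamT omb mub. lamT > (0::real) \<and> omb \<le> rank (Upsilon Phi Lam \<theta>)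
            \<and> inj_on mub {1..omb}
            \<and> loewner_ge (Upsilon Phi Lam \<theta>) (lamT *\<^sub>R (\<Sum>k'\<in>{1..omb}. Emat (mub k')))
            \<and> omb = CARD('n))
       \<or> (\<exists>lamT omb mub k. lamT > (0::real) \<and> omb \<le> rank (Upsilon Phi Lam \<theta>)
            \<and> inj_on mub {1..omb}
            \<and> loewner_ge (Upsilon Phi Lam \<theta>) (lamT *\<^sub>R (\<Sum>k'\<in>{1..omb}. Emat (mub k')))
            \<and> k \<in> {1..omb}
            \<and> krylov_dim (Phi \<theta>) (uvec (mub k)) = CARD('n))"
  shows "\<forall>t\<ge>0. pos_def (Sigma_d Phi Lam \<theta> \<epsilon> t)"
proof (intro allI impI)
  fix t :: real assume t: "t \<ge> 0"
  have decay: "matpow (Phi \<theta>) \<longlonglongrightarrow> 0"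
    using CM unfolding CMbar_def by (intro matpow_tendsto_zero) blast
  have U: "pos_semidef (Upsilon Phi Lam \<theta>)"
    by (rule pos_semidef_Upsilon)
  have controllable: "lyapunov_controllable (Phi \<theta>) (Upsilon Phi Lam \<theta>)"
    using cases U
    by (elim disjE exE conjE)
      (simp_all add: lyapunov_controllable_if_full_rank lyapunov_controllable_if_loewner_ge_coordinates
        lyapunov_controllable_if_orthogonal_diagonalization_krylov lyapunov_controllable_if_loewner_ge_krylov)
  have "\<exists>!S. transpose S = S \<and> Phi \<theta> ** S ** transpose (Phi \<theta>) - S + \<epsilon> *\<^sub>R Upsilon Phi Lam \<theta> = 0"
    using U by (intro lyapunov_equation_unique_symmetric_solution[OF decay]) (simp add: pos_semidef_def)
  then have "transpose (Sigma_d0 Phi Lam \<theta> \<epsilon>) = Sigma_d0 Phi Lam \<theta> \<epsilon>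
    \<and> Phi \<theta> ** Sigma_d0 Phi Lam \<theta> \<epsilon> ** transpose (Phi \<theta>) - Sigma_d0 Phi Lam \<theta> \<epsilon>
      + \<epsilon> *\<^sub>R Upsilon Phi Lam \<theta> = 0"
    unfolding Sigma_d0_def by (rule theI')
  then have "pos_def (Sigma_d0 Phi Lam \<theta> \<epsilon>)"
    by (elim conjE) (rule pos_def_lyapunov_solution[OF decay _ _ eps_pos U controllable])
  then show "pos_def (Sigma_d Phi Lam \<theta> \<epsilon> t)"
    unfolding Sigma_d_def using fundamental_matrix_invertible[OF D_cont fund t] eps_pos
    by (intro pos_def_congruence_add_pos_semidef pos_semidef_Upsilon) simp_all
qed

end
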